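(* Let $H$ be a (multiplicatively written) monoid with identity $1_H$, and let $A$ and $S$ be subsets of $H$ with $1_H \notin A \cup S$. The following are equivalent: (a) Every element of $S$ factors as a non-empty product of elements of $A$. (b) There exists a strongly artinian preorder $\preceq$ on $H$ such that every $x \in S$ is a $\preceq$-non-unit and, for each $a \in H$, the following three conditions are equivalent: $a$ is $\preceq$-irreducible; $a$ is a $\preceq$-quark; $a \in A$. (c) There exists an artinian preorder $\preceq$ on $H$ such that every $x \in S$ is a $\preceq$-non-unit and every $\preceq$-irreducible is an element of $A$.
   Context: A preorder is a reflexive and transitive binary relation; no compatibility with the monoid operation is assumed. Let $\preceq$ be a preorder on (the underlying set of) a monoid $H$. Write $x \prec y$ if $x \preceq y$ and $y \not\preceq x$. An element $u \in H$ is a $\preceq$-unit if $u \preceq 1_H \preceq u$, and a $\preceq$-non-unit otherwise. A $\preceq$-quark is a $\preceq$-non-unit $a \in H$ such that there is no $\preceq$-non-unit $b$ with $b \prec a$. A $\preceq$-irreducible is a $\preceq$-non-unit $a \in H$ such that $a \neq xy$ for all $\preceq$-non-units $x, y \in H$ with $x \prec a$ and $y \prec a$. The preorder $\preceq$ is artinian if there is no infinite sequence $x_1, x_2, \ldots$ of elements of $H$ with $x_{n+1} \prec x_n$ for each $n \ge 1$. The $\preceq$-height of $x \in H$ is the supremum of the set of all integers $n \ge 1$ for which there are $\preceq$-non-units $x_1, \ldots, x_n \in H$ with $x_1 = x$ and $x_{k+1} \prec x_k$ for each $k \in \{1, \ldots, n-1\}$ (where $\sup \emptyset := 0$). The preorder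 $\preceq$ is strongly artinian if every element of $H$ has finite $\preceq$-height. *)

theory Defs
  imports Main "HOL-Library.Extended_Nat"
begin

text \<open>The underlying set of the monoid is a whole type of class \<open>monoid_mult\<close>; \<open>le\<close> is an
  arbitrary relation on it, unrelated to any type-class order and to multiplication.\<close>

definition is_preorder :: "('a \<Rightarrow> 'a \<Rightarrow> bool) \<Rightarrow> bool" where
  "is_preorder le \<longleftrightarrow> reflp le \<and> transp le"

definition strict :: "('a \<Rightarrow> 'a \<Rightarrow> bool) \<Rightarrow> 'a \<Rightarrow> 'a \<Rightarrow> bool" where
  "strict le x y \<longleftrightarrow> le x y \<and> \<not> le y x"

definition le_unit :: "('a::monoid_mult \<Rightarrow> 'a \<Rightarrow> bool) \<Rightarrow> 'a \<Rightarrow> bool" where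
  "le_unit le u \<longleftrightarrow> le u 1 \<and> le 1 u"

abbreviation le_nonunit :: "('a::monoid_mult \<Rightarrow> 'a \<Rightarrow> bool) \<Rightarrow> 'a \<Rightarrow> bool" where
  "le_nonunit le u \<equiv> \<not> le_unit le u"

definition le_quark :: "('a::monoid_mult \<Rightarrow> 'a \<Rightarrow> bool) \<Rightarrow> 'a \<Rightarrow> bool" where
  "le_quark le a \<longleftrightarrow> le_nonunit le a \<and> \<not> (\<exists>b. le_nonunit le b \<and> strict le b a)"

definition le_irreducible :: "('a::monoid_mult \<Rightarrow> 'a \<Rightarrow> bool) \<Rightarrow> 'a \<Rightarrow> bool" where
  "le_irreducible le a \<longleftrightarrow> le_nonunit le a \<and>
     (\<forall>x y. le_nonunit le x \<and> le_nonunit le y \<and> strict le x a \<and> strict le y a \<longrightarrow> a \<noteq> x * y)"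

definition artinian :: "('a \<Rightarrow> 'a \<Rightarrow> bool) \<Rightarrow> bool" where
  "artinian le \<longleftrightarrow> \<not> (\<exists>x :: nat \<Rightarrow> 'a. \<forall>n. strict le (x (Suc n)) (x n))"

text \<open>The supremum is taken in \<open>enat\<close>, where \<open>Sup {} = 0\<close>. Only the values of the
  sequence \<open>z\<close> at \<open>1, \<dots>, n\<close> matter.\<close>

definition height :: "('a::monoid_mult \<Rightarrow> 'a \<Rightarrow> bool) \<Rightarrow> 'a \<Rightarrow> enat" where
  "height le x = Sup {enat n | n. n \<ge> 1 \<and>
     (\<exists>z :: nat \<Rightarrow> 'a. (\<forall>k\<in>{1..n}. le_nonunit le (z k)) \<and> z 1 = x \<and>
        (\<forall>k\<in>{1..<n}. strict le (z (k + 1)) (z k)))}"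

definition strongly_artinian :: "('a::monoid_mult \<Rightarrow> 'a \<Rightarrow> bool) \<Rightarrow> bool" where
  "strongly_artinian le \<longleftrightarrow> (\<forall>x. height le x < \<infinity>)"

definition nonempty_product_of :: "'a::monoid_mult set \<Rightarrow> 'a \<Rightarrow> bool" where
  "nonempty_product_of A x \<longleftrightarrow> (\<exists>as. as \<noteq> [] \<and> set as \<subseteq> A \<and> x = prod_list as)"

end

theory Submission
  imports Defs
begin

text \<open>Given factorizations, rank each element by the least length of a factorization over \<open>A\<close>,
  with rank 0 for elements that do not factor, and compare elements by rank. The non-units are the
  elements of positive rank; the elements of rank 1 are those of \<open>A\<close>, and an element of larger
  rank is the product of the first factor and of the rest of a shortest factorization, both of
  smaller positive rank. Conversely, an artinian preorder allows well-founded induction: a non-unit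
  is irreducible or the product of two strictly smaller non-units.\<close>

lemma nonempty_product_of_single: "a \<in> A \<Longrightarrow> nonempty_product_of A a"
  unfolding nonempty_product_of_def by (rule exI[of _ "[a]"]) simp

lemma nonempty_product_of_mult:
  assumes "nonempty_product_of A x" "nonempty_product_of A y"
  shows "nonempty_product_of A (x * y)"
proof -
  from assms obtain as bs where "as \<noteq> []" "set as \<subseteq> A" "x = prod_list as"
    and "set bs \<subseteq> A" "y = prod_list bs"
    unfolding nonempty_product_of_def by blast
  then show ?thesis
    unfolding nonempty_product_of_def by (intro exI[of _ "as @ bs"]) simp
qed

text \<open>Absence of infinite descending sequences is turned into well-foundedness, which makes
  induction along \<open>strict le\<close> available.\<close>

lemma artinian_wfP: "artinian le \<longleftrightarrow> wfP (strict le)"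
  unfolding artinian_def wfp_def wf_iff_no_infinite_down_chain by simp

lemma artinian_nonempty_product_of:
  assumes "artinian le" and irr: "\<And>a. le_irreducible le a \<Longrightarrow> a \<in> A"
    and "le_nonunit le x"
  shows "nonempty_product_of A x"
  using assms(1)[unfolded artinian_wfP] assms(3)
proof (induction x rule: wfp_induct_rule)
  case (less x)
  show ?case
  proof (cases "le_irreducible le x")
    case True
    then show ?thesis by (simp add: irr nonempty_product_of_single)
  next
    case False
    with less.prems obtain y z where
      "le_nonunit le y" "le_nonunit le z" "strict le y x" "strict le z x" "x = y * z"
      unfolding le_irreducible_def by blast
    then show ?thesis using less.IH nonempty_product_of_mult by blast
  qed
qed

lemma height_ge:
  assumes "n \<ge> 1" "\<And>k. k \<in> {1..n} \<Longrightarrow> le_nonunit le (z k)" "z 1 = x"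
    and "\<And>k. k \<in> {1..<n} \<Longrightarrow> strict le (z (k + 1)) (z k)"
  shows "enat n \<le> height le x"
  unfolding height_def using assms by (intro Sup_upper) blast

lemma strict_trans:
  assumes "is_preorder le" "strict le x y" "strict le y z"
  shows "strict le x z"
  using assms unfolding is_preorder_def strict_def by (meson transpD)

text \<open>All units are equivalent to \<open>1\<close>, hence to each other, so none lies strictly
  below another.\<close>

lemma strict_unit_nonunit:
  assumes "is_preorder le" "le_unit le y" "strict le x y"
  shows "le_nonunit le x"
  using assms unfolding is_preorder_def strict_def le_unit_def by (meson transpD)

text \<open>An infinite descent has a tail of non-units, and the first element of that tail starts
  chains of every finite length, so its height would be infinite.\<close>

lemma strongly_artinian_imp_artinian:
  assumes pre: "is_preorder le" and "strongly_artinian le"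
  shows "artinian le"
  unfolding artinian_def
proof
  assume "\<exists>x. \<forall>n::nat. strict le (x (Suc n)) (x n)"
  then obtain x where x: "\<And>n::nat. strict le (x (Suc n)) (x n)" by blast
  have desc: "strict le (x n) (x m)" if "m < n" for m n
    using that by (induction rule: less_Suc_induct) (auto intro: x strict_trans[OF pre])
  \<comment> \<open>A strictly decreasing sequence contains at most one unit, so some tail avoids units.\<close>
  obtain N where N: "\<And>n. n \<ge> N \<Longrightarrow> le_nonunit le (x n)"
  proof (cases "\<exists>m. le_unit le (x m)")
    case True
    then obtain m where "le_unit le (x m)" ..
    then have "\<And>n. n \<ge> Suc m \<Longrightarrow> le_nonunit le (x n)"
      using strict_unit_nonunit[OF pre _ desc] by (simp add: Suc_le_eq)
    then show ?thesis by (rule that)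
  qed (use that in blast)
  have "enat n \<le> height le (x N)" if "n \<ge> 1" for n
    \<comment> \<open>\<open>height\<close> indexes chains from 1, hence the shift: position 1 of
      the chain is \<open>x N\<close>.\<close>
    by (rule height_ge[where z = "\<lambda>k. x (N + k - 1)"]) (use that in \<open>auto intro: desc simp: N\<close>)
  moreover obtain h where "height le (x N) = enat h"
    using assms(2) unfolding strongly_artinian_def by (metis less_infinityE)
  ultimately have "Suc h \<le> h" by (metis enat_ord_simps(1) le_add1 plus_1_eq_Suc)
  then show False by simp
qed

abbreviation rank_le :: "('a \<Rightarrow> nat) \<Rightarrow> 'a \<Rightarrow> 'a \<Rightarrow> bool" where
  "rank_le f x y \<equiv> f x \<le> f y"

lemma is_preorder_rank_le: "is_preorder (rank_le f)"
  unfolding is_preorder_def by (auto intro!: reflpI transpI)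

lemma strict_rank_le: "strict (rank_le f) x y \<longleftrightarrow> f x < f y"
  unfolding strict_def by auto

lemma le_unit_rank_le: "f 1 = 0 \<Longrightarrow> le_unit (rank_le f) x \<longleftrightarrow> f x = 0"
  unfolding le_unit_def by auto

text \<open>Each strict step lowers \<open>f\<close> by at least 1, and the last non-unit of a chain
  still has positive value.\<close>

lemma height_rank_le:
  assumes "f 1 = 0"
  shows "height (rank_le f) x \<le> enat (f x)"
  unfolding height_def
proof (rule Sup_least, clarify)
  fix n and z :: "nat \<Rightarrow> 'a"
  assume n: "1 \<le> n" and nonunit: "\<forall>k\<in>{1..n}. le_nonunit (rank_le f) (z k)"
    and desc: "\<forall>k\<in>{1..<n}. strict (rank_le f) (z (k + 1)) (z k)"
  have "f (z k) + k \<le> f (z 1) + 1" if "1 \<le> k" "k \<le> n" for k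
    using that
  proof (induction k rule: dec_induct)
    case (step k)
    then show ?case using bspec[OF desc, of k] by (simp add: strict_rank_le)
  qed simp
  \<comment> \<open>At \<open>k = n\<close> the bound loses its extra 1, because \<open>z n\<close>
    is a non-unit and so \<open>f (z n) \<ge> 1\<close>.\<close>
  from this[of n] n nonunit show "enat n \<le> enat (f (z 1))"
    by (force simp: le_unit_rank_le[of f, OF assms])
qed

lemma strongly_artinian_rank_le: "f 1 = 0 \<Longrightarrow> strongly_artinian (rank_le f)"
  unfolding strongly_artinian_def
  using le_less_trans[OF height_rank_le enat_ord_simps(4)[THEN iffD2]] by auto

text \<open>The empty list is allowed, which gives \<open>1\<close> rank 0. The default 0 puts all
  elements without a factorization among the units as well.\<close>

definition factor_rank :: "'a::monoid_mult set \<Rightarrow> 'a \<Rightarrow> nat" where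
  "factor_rank A x = (if \<exists>as. set as \<subseteq> A \<and> x = prod_list as
     then LEAST n. \<exists>as. set as \<subseteq> A \<and> x = prod_list as \<and> length as = n else 0)"

lemma factor_rank_le:
  assumes "set as \<subseteq> A"
  shows "factor_rank A (prod_list as) \<le> length as"
  unfolding factor_rank_def using assms by (auto intro: Least_le)

lemma factor_rank_1: "factor_rank A 1 = 0"
  using factor_rank_le[of "[]" A] by simp

lemma factor_rankE:
  assumes "set bs \<subseteq> A" "x = prod_list bs"
  obtains as where "set as \<subseteq> A" "x = prod_list as" "length as = factor_rank A x"
proof -
  let ?P = "\<lambda>n. \<exists>as. set as \<subseteq> A \<and> x = prod_list as \<and> length as = n"
  have ex: "\<exists>as. set as \<subseteq> A \<and> x = prod_list as" using assms by blast
  then have "\<exists>n. ?P n" by blast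
  then have "?P (Least ?P)" by (rule LeastI_ex)
  then have "?P (factor_rank A x)" unfolding factor_rank_def if_P[OF ex] .
  then show ?thesis using that by blast
qed

text \<open>Rank 0 would be attained by the empty list, whose product is \<open>1\<close>.\<close>

lemma factor_rank_pos:
  assumes "set bs \<subseteq> A" "x = prod_list bs" "x \<noteq> 1"
  shows "factor_rank A x > 0"
  using factor_rankE[OF assms(1,2)] assms(3) by (metis length_greater_0_conv prod_list.Nil)

text \<open>A positive rank cannot be the default value, so a factorization exists.\<close>

lemma factor_rank_posE:
  assumes "factor_rank A x > 0"
  obtains as where "set as \<subseteq> A" "x = prod_list as" "length as = factor_rank A x"
proof -
  have "\<exists>bs. set bs \<subseteq> A \<and> x = prod_list bs"
  proof (rule ccontr)
    assume "\<not> ?thesis"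
    then have "factor_rank A x = 0" unfolding factor_rank_def by (rule if_not_P)
    with assms show False by simp
  qed
  then obtain bs where "set bs \<subseteq> A" "x = prod_list bs" by blast
  then show ?thesis using that by (rule factor_rankE)
qed

lemma factor_rank_eq_1_iff:
  assumes "1 \<notin> A"
  shows "factor_rank A x = 1 \<longleftrightarrow> x \<in> A"
proof
  assume *: "factor_rank A x = 1"
  then have "factor_rank A x > 0" by simp
  then obtain as where "set as \<subseteq> A" "x = prod_list as" "length as = factor_rank A x"
    by (rule factor_rank_posE)
  with * show "x \<in> A" by (auto simp: length_Suc_conv)
next
  assume "x \<in> A"
  with assms have "x \<noteq> 1" by blast
  with \<open>x \<in> A\<close> show "factor_rank A x = 1"
    using factor_rank_le[of "[x]" A] factor_rank_pos[of "[x]" A x] by simp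
qed

lemma factor_rank_decompose:
  assumes "1 \<notin> A" "factor_rank A x > 1"
  obtains a y where "a \<in> A" "x = a * y" "0 < factor_rank A y" "factor_rank A y < factor_rank A x"
proof -
  from assms(2) have "factor_rank A x > 0" by simp
  then obtain as where as: "set as \<subseteq> A" "x = prod_list as" "length as = factor_rank A x"
    by (rule factor_rank_posE)
  with assms(2) obtain a bs where [simp]: "as = a # bs" by (cases as) auto
  have "factor_rank A (prod_list bs) < factor_rank A x"
    using factor_rank_le[of bs A] as by simp
  \<comment> \<open>Otherwise \<open>x = a\<close> would lie in \<open>A\<close> and have rank
    1.\<close>
  moreover have "prod_list bs \<noteq> 1"
    using as assms factor_rank_eq_1_iff[OF assms(1), of x] by auto
  then have "0 < factor_rank A (prod_list bs)"
    using factor_rank_pos[of bs A] as by simp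
  ultimately show ?thesis using that[of a "prod_list bs"] as by simp
qed

lemma quark_imp_irreducible: "le_quark le a \<Longrightarrow> le_irreducible le a"
  unfolding le_quark_def le_irreducible_def by blast

text \<open>Every quark is irreducible, so it suffices that elements of \<open>A\<close> are quarks,
  as 1 is the least positive rank, and that irreducibles lie in \<open>A\<close>, as an element of
  rank above 1 splits.\<close>

lemma
  assumes "1 \<notin> A"
  shows quark_factor_rank: "le_quark (rank_le (factor_rank A)) x \<longleftrightarrow> x \<in> A"
    and irreducible_factor_rank: "le_irreducible (rank_le (factor_rank A)) x \<longleftrightarrow> x \<in> A"
proof -
  let ?r = "factor_rank A"
  note simps = strict_rank_le le_unit_rank_le[of ?r, OF factor_rank_1]
  note one = factor_rank_eq_1_iff[OF assms]
  have quark: "le_quark (rank_le ?r) x" if "x \<in> A"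
    using that one[of x] unfolding le_quark_def simps by auto
  have irr: "x \<in> A" if "le_irreducible (rank_le ?r) x"
  proof (rule ccontr)
    assume "x \<notin> A"
    with that one[of x] have "?r x > 1"
      unfolding le_irreducible_def simps by linarith
    with assms obtain a y where ay: "a \<in> A" "x = a * y" "0 < ?r y" "?r y < ?r x"
      by (rule factor_rank_decompose)
    \<comment> \<open>The head \<open>a\<close> is strictly below \<open>x\<close> as well: its rank
      is 1, while that of \<open>x\<close> exceeds 1.\<close>
    from ay(1) have "?r a = 1" by (simp only: one)
    with ay \<open>?r x > 1\<close> have "?r a \<noteq> 0" "?r y \<noteq> 0" "?r a < ?r x" by simp_all
    with that ay(2,4) show False
      unfolding le_irreducible_def simps by blast
  qed
  show "le_quark (rank_le ?r) x \<longleftrightarrow> x \<in> A" "le_irreducible (rank_le ?r) x \<longleftrightarrow> x \<in> A"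
    using quark irr quark_imp_irreducible by blast+
qed

theorem proposition2p8:
  fixes A S :: "'a::monoid_mult set"
  assumes "1 \<notin> A \<union> S"
  shows
    "((\<forall>x\<in>S. nonempty_product_of A x)
      \<longleftrightarrow>
      (\<exists>le :: 'a \<Rightarrow> 'a \<Rightarrow> bool. is_preorder le \<and> strongly_artinian le \<and>
         (\<forall>x\<in>S. le_nonunit le x) \<and>
         (\<forall>a. (le_irreducible le a \<longleftrightarrow> le_quark le a) \<and> (le_quark le a \<longleftrightarrow> a \<in> A))))
     \<and>
     ((\<forall>x\<in>S. nonempty_product_of A x)
      \<longleftrightarrow>
      (\<exists>le :: 'a \<Rightarrow> 'a \<Rightarrow> bool. is_preorder le \<and> artinian le \<and>
         (\<forall>x\<in>S. le_nonunit le x) \<and>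
         (\<forall>a. le_irreducible le a \<longrightarrow> a \<in> A)))"
proof -
  let ?a = "\<forall>x\<in>S. nonempty_product_of A x"
  let ?b = "\<lambda>le. is_preorder le \<and> strongly_artinian le \<and> (\<forall>x\<in>S. le_nonunit le x) \<and>
    (\<forall>a. (le_irreducible le a \<longleftrightarrow> le_quark le a) \<and> (le_quark le a \<longleftrightarrow> a \<in> A))"
  let ?c = "\<lambda>le. is_preorder le \<and> artinian le \<and> (\<forall>x\<in>S. le_nonunit le x) \<and>
    (\<forall>a. le_irreducible le a \<longrightarrow> a \<in> A)"
  have "?b (rank_le (factor_rank A))" if ?a
  proof -
    have "le_nonunit (rank_le (factor_rank A)) x" if "x \<in> S" for x
    proof -
      have "x \<noteq> 1" using assms \<open>x \<in> S\<close> by blast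
      moreover obtain as where "set as \<subseteq> A" "x = prod_list as"
        using \<open>?a\<close> \<open>x \<in> S\<close> unfolding nonempty_product_of_def by blast
      ultimately show ?thesis
        using factor_rank_pos[of as A x] by (simp add: le_unit_rank_le[of "factor_rank A", OF factor_rank_1])
    qed
    then show ?thesis
      using assms by (simp add: is_preorder_rank_le quark_factor_rank irreducible_factor_rank
          strongly_artinian_rank_le[of "factor_rank A", OF factor_rank_1])
  qed
  then have ab: "\<exists>le. ?b le" if ?a
    using that by (intro exI[of _ "rank_le (factor_rank A)"]) simp
  \<comment> \<open>The same preorder serves for both conditions; the three implications then close
    a cycle.\<close>
  have bc: "?b le \<Longrightarrow> ?c le" for le
    using strongly_artinian_imp_artinian by blast
  have ca: "?c le \<Longrightarrow> ?a" for le
    using artinian_nonempty_product_of by blast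
  show ?thesis using ab bc ca by (intro conjI iffI; blast)
qed

end
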